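(* Let $n\ge 1$, let $p\in\mathbb Z^n$ be a primitive vector and let $\Psi:\mathbb Z^n\to\mathbb Z$, $\Psi(z)=\min(0,p\cdot z)$. The sequence of $k$-huskings $(\Psi)_k$ stabilises eventually as $k\to\infty$, i.e. there exists $N>0$ such that $(\Psi)_k\equiv(\Psi)_N$ for all $k>N$. Moreover, $(\Psi)_N$ coincides with $\Psi$ outside a finite neighborhood of $D(\Psi)$, i.e. there is $C>0$ with $\{z:(\Psi)_N(z)\ne\Psi(z)\}\subset B_C(D(\Psi))$.
   Context: A vector $p\in\mathbb Z^n\setminus\{0\}$ is primitive if there are no integer $k>1$ and $p'\in\mathbb Z^n$ with $p=kp'$. For $z,z'\in\mathbb Z^n$, $z\sim z'$ means that their Euclidean distance is $1$. The discrete Laplacian is $\Delta F(z)=-2nF(z)+\sum_{z'\sim z}F(z')$; $F$ is superharmonic if $\Delta F\le 0$ everywhere. The deviation set of $F$ is $D(F)=\{z\in\mathbb Z^n:\Delta F(z)\ne 0\}$. For $S\subset\mathbb Z^n$ and $C>0$, $B_C(S)\subset\mathbb Z^n$ is the set of points whose Euclidean distance to $S$ is at most $C$. For a superharmonic $F:\mathbb Z^n\to\mathbb Z$ and $k\in\mathbb Z_{\ge0}$, $$\Theta_k(F)=\{G:\mathbb Z^n\to\mathbb Z \mid \Delta G\le 0,\ F-k\le G\le F,\ \exists C>0:\ \{F\ne G\}\subset B_C(D(F))\},$$ and the $k$-husking of $F$ is the function $(F)_k(z)=\min\{G(z): G\in\Theta_k(F)\}$. *)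

theory Defs
  imports "HOL-Analysis.Analysis"
begin

text \<open>
  The lattice $\mathbb{Z}^n$ is the type \<open>int ^ 'n\<close> with $n =$ \<open>CARD('n)\<close>; Euclidean distances are
  taken in \<open>real ^ 'n\<close> via the embedding below.
\<close>

definition real_vec :: "int ^ 'n \<Rightarrow> real ^ 'n" where
  "real_vec z = (\<chi> i. real_of_int (z $ i))"

lemma dist_real_vec:
  "dist (real_vec z) (real_vec w) = sqrt (\<Sum>i\<in>UNIV. (real_of_int (z $ i - w $ i))\<^sup>2)"
  by (simp add: real_vec_def dist_vec_def L2_set_def dist_real_def)

lemma finite_lattice_dist_le:
  fixes z :: "int ^ 'n"
  shows "finite {w. dist (real_vec z) (real_vec w) \<le> r}"
proof (rule finite_subset)
  let ?box = "{f. \<forall>i. f i \<in> {z $ i - \<lceil>r\<rceil>..z $ i + \<lceil>r\<rceil>}} :: ('n \<Rightarrow> int) set"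
  have "finite (Pi\<^sub>E UNIV (\<lambda>i::'n. {z $ i - \<lceil>r\<rceil>..z $ i + \<lceil>r\<rceil>}))"
    by (rule finite_PiE) auto
  moreover have "?box = Pi\<^sub>E UNIV (\<lambda>i. {z $ i - \<lceil>r\<rceil>..z $ i + \<lceil>r\<rceil>})"
    by (auto simp: PiE_def Pi_def)
  ultimately have "finite ?box"
    by simp
  then show "finite (vec_lambda ` ?box)"
    by (rule finite_imageI)
  show "{w. dist (real_vec z) (real_vec w) \<le> r} \<subseteq> vec_lambda ` ?box"
  proof
    fix w assume "w \<in> {w. dist (real_vec z) (real_vec w) \<le> r}"
    then have w: "dist (real_vec z) (real_vec w) \<le> r" by simp
    have "w $ i \<in> {z $ i - \<lceil>r\<rceil>..z $ i + \<lceil>r\<rceil>}" for i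
    proof -
      have "dist (real_vec z $ i) (real_vec w $ i) \<le> r"
        using dist_vec_nth_le[of "real_vec z" i "real_vec w"] w by linarith
      then have "\<bar>real_of_int (z $ i) - real_of_int (w $ i)\<bar> \<le> r"
        by (simp add: real_vec_def dist_real_def)
      then show ?thesis by (simp, linarith)
    qed
    then have "(($) w) \<in> ?box" by simp
    moreover have "w = vec_lambda (($) w)" by simp
    ultimately show "w \<in> vec_lambda ` ?box" by blast
  qed
qed

definition primitive_vec :: "int ^ 'n \<Rightarrow> bool" where
  "primitive_vec p \<longleftrightarrow> p \<noteq> 0 \<and> \<not> (\<exists>k>1. \<exists>p'. p = k *s p')"

definition neighbours :: "int ^ 'n \<Rightarrow> (int ^ 'n) set" where
  "neighbours z = {z'. dist (real_vec z) (real_vec z') = 1}"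

lemma finite_neighbours: "finite (neighbours z)"
  by (rule finite_subset[OF _ finite_lattice_dist_le[of z 1]]) (auto simp: neighbours_def)

definition laplacian :: "(int ^ 'n \<Rightarrow> int) \<Rightarrow> int ^ 'n \<Rightarrow> int" where
  "laplacian F z = - 2 * int CARD('n) * F z + (\<Sum>z'\<in>neighbours z. F z')"

definition superharmonic :: "(int ^ 'n \<Rightarrow> int) \<Rightarrow> bool" where
  "superharmonic F \<longleftrightarrow> (\<forall>z. laplacian F z \<le> 0)"

definition deviation_set :: "(int ^ 'n \<Rightarrow> int) \<Rightarrow> (int ^ 'n) set" where
  "deviation_set F = {z. laplacian F z \<noteq> 0}"

text \<open>
  The library sets \<open>infdist z {} = 0\<close>; the guard \<open>S \<noteq> {}\<close> restores the usual convention that the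
  distance to the empty set is infinite.
\<close>

definition lattice_nbhd :: "real \<Rightarrow> (int ^ 'n) set \<Rightarrow> (int ^ 'n) set" where
  "lattice_nbhd C S = {z. S \<noteq> {} \<and> infdist (real_vec z) (real_vec ` S) \<le> C}"

lemma mem_lattice_nbhd_iff: "z \<in> lattice_nbhd C S \<longleftrightarrow> (\<exists>s\<in>S. dist (real_vec z) (real_vec s) \<le> C)"
proof
  assume "\<exists>s\<in>S. dist (real_vec z) (real_vec s) \<le> C"
  then show "z \<in> lattice_nbhd C S"
    by (auto simp: lattice_nbhd_def intro: infdist_le2)
next
  assume "z \<in> lattice_nbhd C S"
  then have ne: "S \<noteq> {}" and le: "infdist (real_vec z) (real_vec ` S) \<le> C"
    by (auto simp: lattice_nbhd_def)
  let ?T = "{s \<in> S. dist (real_vec z) (real_vec s) \<le> C + 1}"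
  have fin: "finite ?T"
    by (rule finite_subset[OF _ finite_lattice_dist_le[of z "C + 1"]]) auto
  show "\<exists>s\<in>S. dist (real_vec z) (real_vec s) \<le> C"
  proof (rule ccontr)
    assume "\<not> (\<exists>s\<in>S. dist (real_vec z) (real_vec s) \<le> C)"
    then have gt: "\<And>s. s \<in> S \<Longrightarrow> C < dist (real_vec z) (real_vec s)" by force
    define m where "m = Min (insert (C + 1) ((\<lambda>s. dist (real_vec z) (real_vec s)) ` ?T))"
    have "m > C" using fin gt by (auto simp: m_def)
    moreover have "m \<le> dist (real_vec z) (real_vec s)" if "s \<in> S" for s
    proof (cases "dist (real_vec z) (real_vec s) \<le> C + 1")
      case True
      then show ?thesis using fin that by (auto simp: m_def intro: Min_le)
    next
      case False
      moreover have "m \<le> C + 1" using fin by (auto simp: m_def intro: Min_le)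
      ultimately show ?thesis by linarith
    qed
    then have "m \<le> infdist (real_vec z) (real_vec ` S)"
      using ne by (auto simp: infdist_def intro: cINF_greatest)
    ultimately show False using le by linarith
  qed
qed

definition husking_class :: "nat \<Rightarrow> (int ^ 'n \<Rightarrow> int) \<Rightarrow> (int ^ 'n \<Rightarrow> int) set" where
  "husking_class k F =
    {G. superharmonic G \<and> (\<forall>z. F z - int k \<le> G z \<and> G z \<le> F z) \<and>
        (\<exists>C>0. {z. F z \<noteq> G z} \<subseteq> lattice_nbhd C (deviation_set F))}"

definition husking :: "nat \<Rightarrow> (int ^ 'n \<Rightarrow> int) \<Rightarrow> int ^ 'n \<Rightarrow> int" where
  "husking k F z = Min {G z | G. G \<in> husking_class k F}"

text \<open>For superharmonic \<open>F\<close> the minimum ranges over a finite nonempty set.\<close>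

lemma finite_husking_values: "finite {G z | G. G \<in> husking_class k F}"
  by (rule finite_subset[of _ "{F z - int k..F z}"]) (auto simp: husking_class_def)

lemma husking_class_self: "superharmonic F \<Longrightarrow> F \<in> husking_class k F"
  by (auto simp: husking_class_def intro: exI[of _ 1])

definition edge_fun :: "int ^ 'n \<Rightarrow> int ^ 'n \<Rightarrow> int" where
  "edge_fun p z = min 0 (scalar_product p z)"

end

theory Submission
  imports Defs
begin

text \<open>
  Minimising an element \<open>G\<close> of a husking class over the fibres of \<open>z \<mapsto> p \<cdot> z\<close> gives an integer
  function \<open>f\<close> on the line that lies below \<open>min 0 t\<close>, agrees with it for large \<open>\<bar>t\<bar>\<close>, and satisfies
  \<open>\<Sum>\<^sub>i f (t + \<bar>p\<^sub>i\<bar>) + f (t - \<bar>p\<^sub>i\<bar>) - 2 * f t \<le> 0\<close>; lower bounds for \<open>f\<close> are lower bounds for \<open>G\<close>.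
  The flux of \<open>f\<close> is a weighted sum of increments of \<open>f\<close> which decreases from \<open>M = \<Sum>\<^sub>i p\<^sub>i\<^sup>2\<close> to \<open>0\<close>.
  By a Harnack argument the increments are bounded in terms of \<open>p\<close> alone. Where the flux is constant, the
  increments are harmonic; being integers in a bounded range, on a long interval they attain a local maximum
  far from the ends and are constant near it, so the flux there is a multiple of \<open>M\<close>. Hence the flux takes
  values strictly between \<open>0\<close> and \<open>M\<close> only on an interval of length bounded in terms of \<open>p\<close>, outside of which
  \<open>f\<close> is \<open>min 0 t\<close>. So all husking classes of large index coincide.
\<close>

section \<open>Integer functions on the line\<close>

text \<open>The steps have gcd 1; a step may be 0. The absolute coordinates of a primitive vector
  are the intended instance.\<close>

locale generating_steps =
  fixes q :: "'i::finite \<Rightarrow> nat"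
  assumes generating: "\<exists>v. m = (\<Sum>i\<in>UNIV. v i * int (q i))"
begin

section \<open>Laplacian with steps \<open>q\<close>, its flux and second moment\<close>

definition lap :: "(int \<Rightarrow> int) \<Rightarrow> int \<Rightarrow> int" where
  "lap f t = (\<Sum>i\<in>UNIV. f (t + int (q i)) + f (t - int (q i)) - 2 * f t)"

text \<open>The current across the cut between \<open>t\<close> and \<open>t + 1\<close>: for step
  \<open>q i\<close>, the increments of \<open>f\<close> along all jumps of that length crossing the
  cut, with their end points paired symmetrically about the cut. Its discrete derivative is
  \<open>lap f\<close>.\<close>

definition flux :: "(int \<Rightarrow> int) \<Rightarrow> int \<Rightarrow> int" where
  "flux f t = (\<Sum>i\<in>UNIV. \<Sum>j<q i. f (t + 1 + int j) - f (t - int j))"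

text \<open>The second moment of the steps, which is the flux of the identity function.\<close>

definition mass :: int where
  "mass = (\<Sum>i\<in>UNIV. (int (q i))\<^sup>2)"

definition range_max :: int where
  "range_max = int (Max (range q))"

lemma step_le_range_max: "int (q i) \<le> range_max"
  by (simp add: range_max_def)

lemma ex_step_pos: "\<exists>i. q i > 0"
proof (rule ccontr)
  assume "\<not> ?thesis"
  then have "q i = 0" for i by simp
  then show False using generating[of 1] by simp
qed

lemma range_max_pos: "range_max > 0"
  using ex_step_pos step_le_range_max by (metis less_le_trans of_nat_0_less_iff)

lemma mass_pos: "mass > 0"
proof -
  obtain i where "q i > 0" using ex_step_pos by blast
  then show ?thesis
    unfolding mass_def by (intro sum_pos2[of _ i]) auto
qed

lemma lap_diff: "lap (\<lambda>t. f t - g t) t = lap f t - lap g t"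
  by (simp add: lap_def flip: sum_subtractf) (rule sum.cong, auto)

lemma lap_uminus: "lap (\<lambda>t. - f t) t = - lap f t"
  unfolding lap_def sum_negf[symmetric] by (rule sum.cong) auto

lemma lap_shift: "lap (\<lambda>t. f (t + a)) t = lap f (t + a)"
  by (simp add: lap_def algebra_simps)

lemma lap_reflect: "lap (\<lambda>t. f (- t)) t = lap f (- t)"
  unfolding lap_def by (rule sum.cong) (auto simp: algebra_simps)

lemma lap_ident: "lap (\<lambda>t. t) t = 0"
  by (simp add: lap_def)

lemma flux_step: "flux f t = flux f (t - 1) + lap f t"
proof -
  have "(\<Sum>j<a. f (t + 1 + int j) - f (t - int j)) =
      (\<Sum>j<a. f (t - 1 + 1 + int j) - f (t - 1 - int j)) + (f (t + int a) + f (t - int a) - 2 * f t)"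
    for a
    by (induction a) (auto simp: algebra_simps)
  then show ?thesis
    by (simp add: flux_def lap_def sum.distrib)
qed

lemma increment_ge:
  fixes f :: "int \<Rightarrow> int"
  assumes "\<And>s. x \<le> s \<Longrightarrow> s < x + int k \<Longrightarrow> f (s + 1) - f s \<ge> c"
  shows "f (x + int k) - f x \<ge> int k * c"
  using assms
proof (induction k)
  case (Suc k)
  have "f (x + int k) - f x \<ge> int k * c"
    by (rule Suc.IH) (use Suc.prems in auto)
  moreover have "f (x + int k + 1) - f (x + int k) \<ge> c"
    by (rule Suc.prems) auto
  ultimately show ?case by (simp add: algebra_simps)
qed simp

text \<open>The term with index \<open>j\<close> telescopes into \<open>2 * j + 1\<close>
  consecutive increments near \<open>t\<close>, and the first \<open>a\<close> odd numbers add up to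
  the square of \<open>a\<close>.\<close>

lemma flux_ge:
  assumes "\<And>s. \<bar>s - t\<bar> \<le> range_max \<Longrightarrow> f (s + 1) - f s \<ge> c"
  shows "flux f t \<ge> mass * c"
proof -
  have odd_sum: "(\<Sum>j<a. int (2 * j + 1) * c) = (int a)\<^sup>2 * c" for a
    by (induction a) (auto simp: algebra_simps power2_eq_square)
  have "mass * c = (\<Sum>i\<in>UNIV. \<Sum>j<q i. int (2 * j + 1) * c)"
    unfolding odd_sum mass_def by (simp add: sum_distrib_right)
  also have "\<dots> \<le> flux f t"
    unfolding flux_def
  proof (intro sum_mono)
    fix i j assume "j \<in> {..<q i}"
    then have j: "int j + 1 \<le> range_max" using step_le_range_max[of i] by simp
    have "f (t - int j + int (2 * j + 1)) - f (t - int j) \<ge> int (2 * j + 1) * c"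
      by (rule increment_ge, rule assms) (use j in auto)
    moreover have "t - int j + int (2 * j + 1) = t + 1 + int j" by simp
    ultimately show "int (2 * j + 1) * c \<le> f (t + 1 + int j) - f (t - int j)" by metis
  qed
  finally show ?thesis .
qed

lemma flux_uminus: "flux (\<lambda>t. - f t) t = - flux f t"
  by (simp add: flux_def flip: sum_negf)

lemma flux_le:
  assumes "\<And>s. \<bar>s - t\<bar> \<le> range_max \<Longrightarrow> f (s + 1) - f s \<le> c"
  shows "flux f t \<le> mass * c"
proof -
  have "flux (\<lambda>t. - f t) t \<ge> mass * (- c)"
    by (rule flux_ge) (use assms in force)
  then show ?thesis by (simp add: flux_uminus)
qed

lemma flux_eq:
  assumes "\<And>s. \<bar>s - t\<bar> \<le> range_max \<Longrightarrow> f (s + 1) - f s = c"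
  shows "flux f t = mass * c"
  by (intro antisym flux_ge flux_le) (use assms in simp_all)

section \<open>Harnack inequality and unique continuation\<close>

lemma steps_induct:
  assumes "P 0" and plus: "\<And>m i. P m \<Longrightarrow> P (m + int (q i))"
    and minus: "\<And>m i. P m \<Longrightarrow> P (m - int (q i))"
  shows "P m"
proof -
  have mult: "P (m + k * int (q i))" if "P m" for m k i
  proof (induction k rule: int_induct[where k = 0])
    case base
    then show ?case using that by simp
  next
    case (step1 k)
    from plus[OF step1(2)] show ?case by (simp add: algebra_simps)
  next
    case (step2 k)
    from minus[OF step2(2)] show ?case by (simp add: algebra_simps)
  qed
  have "P (\<Sum>i\<in>I. v i * int (q i))" if "finite I" for I v
    using that
  proof (induction I rule: finite_induct)
    case empty
    then show ?case using \<open>P 0\<close> by simp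
  next
    case (insert i I)
    then show ?case using mult[OF insert.IH, of "v i" i] by (simp add: algebra_simps)
  qed
  then show ?thesis using generating[of m] by (metis finite)
qed

text \<open>For \<open>c = 0\<close> this is the strong maximum principle.\<close>

lemma harnack_at:
  "\<exists>B C. B \<ge> 0 \<and> C \<ge> 0 \<and> (\<forall>e t0 c. (\<forall>t. \<bar>t - t0\<bar> \<le> B \<longrightarrow> e t \<le> e t0 \<and> lap e t \<ge> - c) \<longrightarrow>
      e (t0 + m) \<ge> e t0 - C * c)"
proof (induction m rule: steps_induct)
  case 1
  then show ?case by (auto intro!: exI[of _ 0])
next
  have step: "\<exists>B C. B \<ge> 0 \<and> C \<ge> 0 \<and>
      (\<forall>e t0 c. (\<forall>t. \<bar>t - t0\<bar> \<le> B \<longrightarrow> e t \<le> e t0 \<and> lap e t \<ge> - c) \<longrightarrow>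
        e (t0 + (m + \<sigma> * int (q i))) \<ge> e t0 - C * c)"
    if "\<exists>B C. B \<ge> 0 \<and> C \<ge> 0 \<and>
      (\<forall>e t0 c. (\<forall>t. \<bar>t - t0\<bar> \<le> B \<longrightarrow> e t \<le> e t0 \<and> lap e t \<ge> - c) \<longrightarrow>
        e (t0 + m) \<ge> e t0 - C * c)" and \<sigma>: "\<sigma> = 1 \<or> \<sigma> = - 1" for m i \<sigma>
  proof -
    from that obtain B C where BC: "B \<ge> 0" "C \<ge> 0"
      and H: "\<And>e t0 c. (\<forall>t. \<bar>t - t0\<bar> \<le> B \<longrightarrow> e t \<le> e t0 \<and> lap e t \<ge> - c) \<Longrightarrow>
        e (t0 + m) \<ge> e t0 - C * c" by blast
    define n where "n = int CARD('i)"
    \<comment> \<open>The window must contain the one of the induction hypothesis as well as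
      \<open>t0 + m\<close> and all points one step away from it.\<close>
    define B' where "B' = max B (\<bar>m\<bar> + range_max)"
    have "e (t0 + (m + \<sigma> * int (q i))) \<ge> e t0 - (1 + 2 * n * C) * c"
      if near: "\<forall>t. \<bar>t - t0\<bar> \<le> B' \<longrightarrow> e t \<le> e t0 \<and> lap e t \<ge> - c" for e t0 c
    proof -
      define t where "t = t0 + m"
      define x where "x = e (t + \<sigma> * int (q i))"
      have et: "e t \<ge> e t0 - C * c"
        unfolding t_def by (rule H) (use near in \<open>auto simp: B'_def\<close>)
      have nb: "e (t + int (q j)) \<le> e t0" "e (t - int (q j)) \<le> e t0" for j
        using near step_le_range_max[of j] by (auto simp: B'_def t_def)
      have "- c \<le> lap e t"
        using near range_max_pos by (auto simp: B'_def t_def)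
      \<comment> \<open>All neighbours of \<open>t\<close> are at most \<open>e t0\<close>. Keeping
        the exact value \<open>x\<close> at the chosen neighbour only, the lower bound on
        \<open>lap e t\<close> prevents \<open>x\<close> from being far below
        \<open>e t0\<close>.\<close>
      also have "\<dots> \<le> (\<Sum>j\<in>UNIV. 2 * (e t0 - e t) + (if j = i then x - e t0 else 0))"
        unfolding lap_def
      proof (rule sum_mono)
        fix j
        show "e (t + int (q j)) + e (t - int (q j)) - 2 * e t
            \<le> 2 * (e t0 - e t) + (if j = i then x - e t0 else 0)"
          using nb[of j] \<sigma> by (auto simp: x_def)
      qed
      also have "\<dots> = n * (2 * (e t0 - e t)) + (x - e t0)"
        by (simp add: sum.distrib n_def sum.delta)
      finally have 1: "x \<ge> e t0 - c - n * (2 * (e t0 - e t))" by simp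
      have "n * (2 * (e t0 - e t)) \<le> n * (2 * (C * c))"
        using et by (intro mult_left_mono) (auto simp: n_def)
      with 1 show ?thesis by (simp add: x_def t_def algebra_simps)
    qed
    moreover have "B' \<ge> 0" "1 + 2 * n * C \<ge> 0"
      using BC by (auto simp: B'_def n_def)
    ultimately show ?thesis by blast
  qed
  { case (2 m i) from step[OF this, of 1 i] show ?case by simp }
  { case (3 m i) from step[OF this, of "-1" i] show ?case by simp }
qed

text \<open>Makes the constants uniform over all points whose increments enter the flux at
  \<open>t0\<close>: a sum of nonnegative constants over the finite window dominates each of
  them.\<close>

lemma harnack:
  obtains B C where "B \<ge> 0" "C \<ge> 0"
    "\<And>e t0 c s. \<lbrakk>\<And>t. \<bar>t - t0\<bar> \<le> B \<Longrightarrow> e t \<le> e t0 \<and> lap e t \<ge> - c; c \<ge> 0; \<bar>s - t0\<bar> \<le> range_max\<rbrakk>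
        \<Longrightarrow> e s \<ge> e t0 - C * c"
proof -
  obtain B C where BC: "\<And>m. B m \<ge> 0" "\<And>m. C m \<ge> 0"
    and H: "\<And>m e t0 c. (\<forall>t. \<bar>t - t0\<bar> \<le> B m \<longrightarrow> e t \<le> e t0 \<and> lap e t \<ge> - c) \<Longrightarrow>
      e (t0 + m) \<ge> e t0 - C m * c"
    using harnack_at by metis
  define W where "W = {- range_max..range_max}"
  have W: "finite W" by (simp add: W_def)
  show thesis
  proof
    show "sum B W \<ge> 0" "sum C W \<ge> 0" using BC by (auto intro: sum_nonneg)
    fix e t0 c s
    assume near: "\<And>t. \<bar>t - t0\<bar> \<le> sum B W \<Longrightarrow> e t \<le> e t0 \<and> lap e t \<ge> - c"
      and c: "c \<ge> 0" and s: "\<bar>s - t0\<bar> \<le> range_max"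
    define m where "m = s - t0"
    have m: "m \<in> W" using s by (auto simp: W_def m_def)
    have "B m \<le> sum B W" "C m \<le> sum C W"
      using member_le_sum[OF m, of B] member_le_sum[OF m, of C] BC W by auto
    then have "e (t0 + m) \<ge> e t0 - C m * c"
      by (intro H) (use near in force)
    moreover have "C m * c \<le> sum C W * c"
      using \<open>C m \<le> sum C W\<close> c by (rule mult_right_mono)
    ultimately show "e s \<ge> e t0 - sum C W * c" by (simp add: m_def)
  qed
qed

text \<open>In the equation at \<open>t - range_max\<close> the rightmost value is
  \<open>h t\<close>, with a positive coefficient; all other values lie further left and vanish by
  induction.\<close>

lemma harmonic_continuation:
  assumes zero: "\<And>t. t < u \<Longrightarrow> h t = 0" and harm: "\<And>t. t \<le> a \<Longrightarrow> lap h t = 0"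
    and "t \<le> a + range_max"
  shows "h t = 0"
  using \<open>t \<le> a + range_max\<close>
proof (induction "nat (t - u)" arbitrary: t rule: less_induct)
  case less
  show ?case
  proof (cases "t < u")
    case False
    define s where "s = t - range_max"
    have prev: "h r = 0" if "r < t" for r
      by (cases "r < u") (use zero less that False in auto)
    have "Max (range q) \<in> range q" by (rule Max_in) auto
    then obtain i where "Max (range q) = q i" by (rule imageE)
    then have i: "int (q i) = range_max" by (simp only: range_max_def)
    have "lap h s = (\<Sum>j\<in>UNIV. if int (q j) = range_max then h t else 0)"
      unfolding lap_def
    proof (rule sum.cong[OF refl])
      fix j
      show "h (s + int (q j)) + h (s - int (q j)) - 2 * h s
          = (if int (q j) = range_max then h t else 0)"
        using step_le_range_max[of j] range_max_pos by (auto simp: s_def prev)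
    qed
    also have "\<dots> = int (card {j. int (q j) = range_max}) * h t"
      by (simp add: sum.If_cases)
    finally have "int (card {j. int (q j) = range_max}) * h t = 0"
      using harm[of s] less.prems by (simp add: s_def)
    moreover have "card {j. int (q j) = range_max} \<noteq> 0"
      using i by auto
    ultimately show ?thesis by simp
  qed (use zero in auto)
qed

section \<open>Profiles, their flux and their increments\<close>

definition profile :: "(int \<Rightarrow> int) \<Rightarrow> bool" where
  "profile f \<longleftrightarrow> (\<forall>t. lap f t \<le> 0) \<and> (\<forall>t. f t \<le> min 0 t) \<and> (\<exists>S. \<forall>t. \<bar>t\<bar> > S \<longrightarrow> f t = min 0 t)"

context
  fixes f assumes prof: "profile f"
begin

lemma flux_antimono: "s \<le> t \<Longrightarrow> flux f t \<le> flux f s"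
proof (induction t rule: int_ge_induct)
  case (step t)
  moreover have "lap f (t + 1) \<le> 0" using prof by (simp add: profile_def)
  ultimately show ?case using flux_step[of f "t + 1"] by simp
qed simp

lemma flux_far: "\<exists>S. S \<ge> 0 \<and> (\<forall>t< - S. flux f t = mass) \<and> (\<forall>t>S. flux f t = 0)"
proof -
  obtain S where S: "\<And>t. \<bar>t\<bar> > S \<Longrightarrow> f t = min 0 t"
    using prof by (auto simp: profile_def)
  define R where "R = \<bar>S\<bar> + range_max + 1"
  have "flux f t = mass * 1" if "t < - R" for t
    by (rule flux_eq) (use that S range_max_pos in \<open>auto simp: R_def\<close>)
  moreover have "flux f t = mass * 0" if "t > R" for t
    by (rule flux_eq) (use that S range_max_pos in \<open>auto simp: R_def\<close>)
  moreover have "R \<ge> 0" using range_max_pos by (simp add: R_def)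
  ultimately show ?thesis by (metis mult.right_neutral mult_zero_right)
qed

lemma flux_bounds: "0 \<le> flux f t" "flux f t \<le> mass"
proof -
  obtain S where S: "\<forall>t< - S. flux f t = mass" "\<forall>t>S. flux f t = 0"
    using flux_far by blast
  have "flux f (max t (S + 1)) \<le> flux f t" "flux f t \<le> flux f (min t (- S - 1))"
    by (auto intro!: flux_antimono)
  moreover have "flux f (max t (S + 1)) = 0" "flux f (min t (- S - 1)) = mass"
    using S by auto
  ultimately show "0 \<le> flux f t" "flux f t \<le> mass" by auto
qed

text \<open>A single drop of the flux cannot exceed its total drop \<open>mass\<close>. This bounds
  the Laplacian of the increments uniformly in \<open>f\<close>, as the Harnack inequality
  requires.\<close>

lemma lap_ge: "lap f t \<ge> - mass"
  using flux_step[of f t] flux_bounds[of t] flux_bounds[of "t - 1"] by linarith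

lemma lap_increment_bound: "\<bar>lap (\<lambda>t. f (t + 1) - f t) t\<bar> \<le> mass"
proof -
  have "lap (\<lambda>t. f (t + 1) - f t) t = lap f (t + 1) - lap f t"
    by (simp add: lap_diff lap_shift)
  moreover have "lap f t \<le> 0" "lap f (t + 1) \<le> 0" using prof by (auto simp: profile_def)
  ultimately show ?thesis using lap_ge[of t] lap_ge[of "t + 1"] by linarith
qed

text \<open>Far out the increments are those of \<open>min 0 t\<close>. The window depends on
  \<open>f\<close>, so this gives no uniform bound, but it ensures that the largest and smallest
  increments are attained.\<close>

lemma finite_increments: "finite (range (\<lambda>t. f (t + 1) - f t))"
proof -
  obtain S where S: "\<And>t. \<bar>t\<bar> > S \<Longrightarrow> f t = min 0 t"
    using prof by (auto simp: profile_def)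
  define J where "J = {- \<bar>S\<bar> - 1..\<bar>S\<bar> + 1}"
  have "f (t + 1) - f t \<in> (\<lambda>t. f (t + 1) - f t) ` J \<union> {0, 1}" for t
  proof (cases "t \<in> J")
    case False
    then have "\<bar>t\<bar> > S" "\<bar>t + 1\<bar> > S" by (auto simp: J_def)
    from S[OF this(1)] S[OF this(2)] show ?thesis by auto
  qed auto
  then have "range (\<lambda>t. f (t + 1) - f t) \<subseteq> (\<lambda>t. f (t + 1) - f t) ` J \<union> {0, 1}" by blast
  then show ?thesis
    by (rule finite_subset) (simp add: J_def)
qed

end

section \<open>Bounds that depend on the steps only\<close>

lemma increment_bound:
  obtains K where "K \<ge> 0" "\<And>f t. profile f \<Longrightarrow> \<bar>f (t + 1) - f t\<bar> \<le> K"
proof -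
  obtain B C where BC: "B \<ge> 0" "C \<ge> 0"
    and H: "\<And>e t0 c s. \<lbrakk>\<And>t. \<bar>t - t0\<bar> \<le> B \<Longrightarrow> e t \<le> e t0 \<and> lap e t \<ge> - c; c \<ge> 0;
        \<bar>s - t0\<bar> \<le> range_max\<rbrakk> \<Longrightarrow> e s \<ge> e t0 - C * c"
    by (erule harnack)
  \<comment> \<open>Around a maximal increment \<open>e t0\<close> the Harnack inequality keeps all
    increments in the flux above \<open>e t0 - C * mass\<close>; since the flux is at most
    \<open>mass\<close>, this forces \<open>e t0 \<le> 1 + C * mass\<close>. The same argument for
    \<open>- e\<close> and the lower bound 0 of the flux handle a minimal increment.\<close>
  define K where "K = 1 + C * mass"
  show thesis
  proof
    show "K \<ge> 0" using BC mass_pos by (simp add: K_def)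
    fix f t assume f: "profile f"
    define e where "e = (\<lambda>t. f (t + 1) - f t)"
    have fin: "finite (range e)" using finite_increments[OF f] by (simp add: e_def)
    have lap_e: "\<bar>lap e t\<bar> \<le> mass" for t using lap_increment_bound[OF f] by (simp add: e_def)
    obtain t0 where t0: "e t0 = Max (range e)"
      using Max_in[OF fin] by (metis UNIV_not_empty image_iff image_is_empty)
    obtain t1 where t1: "e t1 = Min (range e)"
      using Min_in[OF fin] by (metis UNIV_not_empty image_iff image_is_empty)
    have max: "e s \<le> e t0" for s by (simp add: t0 fin)
    have min: "e s \<ge> e t1" for s by (simp add: t1 fin)
    have "e s \<ge> e t0 - C * mass" if "\<bar>s - t0\<bar> \<le> range_max" for s
      by (rule H) (use that max lap_e mass_pos in \<open>auto simp: abs_le_iff minus_le_iff\<close>)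
    then have "flux f t0 \<ge> mass * (e t0 - C * mass)"
      by (intro flux_ge) (simp add: e_def)
    then have "mass * (e t0 - C * mass) \<le> mass * 1" using flux_bounds[OF f, of t0] by simp
    then have up: "e t0 \<le> K" using mass_pos by (simp add: K_def)
    have "- e s \<ge> - e t1 - C * mass" if "\<bar>s - t1\<bar> \<le> range_max" for s
      by (rule H[where e = "\<lambda>t. - e t"])
        (use that min lap_e mass_pos in \<open>auto simp: abs_le_iff minus_le_iff lap_uminus\<close>)
    then have "flux f t1 \<le> mass * (e t1 + C * mass)"
      by (intro flux_le) (force simp: e_def)
    then have "mass * 0 \<le> mass * (e t1 + C * mass)" using flux_bounds[OF f, of t1] by simp
    then have "0 \<le> e t1 + C * mass" using mass_pos mult_le_cancel_left_pos by blast
    then have "- K \<le> e t1" by (simp add: K_def)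
    then show "\<bar>f (t + 1) - f t\<bar> \<le> K"
      using max[of t] min[of t] up by (simp add: e_def abs_le_iff)
  qed
qed

text \<open>The maxima of a bounded integer sequence over nested intervals cannot drop too often, so on
  a long interval one of them is attained far from the boundary of its interval.\<close>

lemma interior_maximum:
  fixes e :: "int \<Rightarrow> int"
  assumes bd: "\<And>t. \<bar>e t\<bar> \<le> K" and "B \<ge> 0" and long: "u + 2 * (2 * K + 1) * B \<le> v"
  obtains (interior) t0 where "u + B \<le> t0" "t0 \<le> v - B" "\<And>t. \<bar>t - t0\<bar> \<le> B \<Longrightarrow> e t \<le> e t0"
proof (rule ccontr)
  assume no: "\<not> thesis"
  define I where "I = (\<lambda>j::nat. {u + int j * B..v - int j * B})"
  have "K \<ge> 0" using bd[of 0] by linarith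
  \<comment> \<open>Without an interior maximum, every point of \<open>I (Suc j)\<close> is exceeded
    by a point of \<open>I j\<close> within distance \<open>B\<close>, and for integers that costs
    at least 1.\<close>
  have drop: "\<forall>t\<in>I j. e t \<le> K - int j" if "j \<le> nat (2 * K + 1)" for j
    using that
  proof (induction j)
    case 0
    then show ?case using bd by (auto simp: abs_le_iff)
  next
    case (Suc j)
    then have IH: "\<And>t. t \<in> I j \<Longrightarrow> e t \<le> K - int j" by simp
    show ?case
    proof
      fix t assume t: "t \<in> I (Suc j)"
      have *: "0 \<le> int j * B" using \<open>B \<ge> 0\<close> by simp
      have near: "s \<in> I j" if "\<bar>s - t\<bar> \<le> B" for s
        using t that by (auto simp: I_def algebra_simps abs_le_iff)
      have "u + B \<le> t" "t \<le> v - B"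
        using t * by (auto simp: I_def algebra_simps)
      with no interior[of t] obtain s where s: "\<bar>s - t\<bar> \<le> B" "e t < e s" by (meson not_le)
      then show "e t \<le> K - int (Suc j)" using IH[OF near[OF s(1)]] by simp
    qed
  qed
  \<comment> \<open>After \<open>2 * K + 1\<close> drops the bound is \<open>- K - 1\<close>, below
    every value of \<open>e\<close>, while \<open>long\<close> keeps the interval nonempty.\<close>
  define j where "j = nat (2 * K + 1)"
  have j: "int j = 2 * K + 1" using \<open>K \<ge> 0\<close> by (simp add: j_def)
  have "u + int j * B \<in> I j"
    using long by (auto simp: I_def j algebra_simps)
  then have "e (u + int j * B) \<le> K - int j" using drop[of j] by (simp add: j_def)
  then show False using bd[of "u + int j * B"] j by linarith
qed

lemma flux_plateau_bound:
  obtains L where "L \<ge> 0" "\<And>f t. \<lbrakk>profile f; 0 < flux f t; flux f t < mass\<rbrakk> \<Longrightarrow> flux f (t + L) < flux f t"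
proof -
  obtain B C where BC: "B \<ge> 0" "C \<ge> 0"
    and H: "\<And>e t0 c s. \<lbrakk>\<And>t. \<bar>t - t0\<bar> \<le> B \<Longrightarrow> e t \<le> e t0 \<and> lap e t \<ge> - c; c \<ge> 0;
        \<bar>s - t0\<bar> \<le> range_max\<rbrakk> \<Longrightarrow> e s \<ge> e t0 - C * c"
    by (erule harnack)
  obtain K where K: "K \<ge> 0" "\<And>f t. profile f \<Longrightarrow> \<bar>f (t + 1) - f t\<bar> \<le> K"
    by (erule increment_bound)
  \<comment> \<open>\<open>B\<close> serves the Harnack inequality, \<open>range_max\<close> the
    evaluation of the flux. In \<open>L\<close>, the summand 2 pays for the ends: constancy of the
    flux on \<open>u..u + L\<close> makes \<open>f\<close> harmonic from \<open>u + 1\<close> on,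
    and its increments harmonic on \<open>u + 1..u + L - 1\<close>.\<close>
  define B' where "B' = B + range_max"
  define L where "L = 2 + 2 * (2 * K + 1) * B'"
  have B': "B' \<ge> 0" using BC range_max_pos by (simp add: B'_def)
  show thesis
  proof
    show "L \<ge> 0" using K(1) B' by (simp add: L_def)
    fix f u assume f: "profile f" and fl: "0 < flux f u" "flux f u < mass"
    show "flux f (u + L) < flux f u"
    proof (rule ccontr)
      assume "\<not> ?thesis"
      then have end_eq: "flux f (u + L) \<ge> flux f u" by simp
      have const: "flux f t = flux f u" if "u \<le> t" "t \<le> u + L" for t
        using flux_antimono[OF f that(1)] flux_antimono[OF f that(2)] end_eq by simp
      define e where "e = (\<lambda>t. f (t + 1) - f t)"
      have harm_f: "lap f t = 0" if "u + 1 \<le> t" "t \<le> u + L" for t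
        using flux_step[of f t] const[of t] const[of "t - 1"] that by simp
      have harm: "lap e t = 0" if "u + 1 \<le> t" "t \<le> u + L - 1" for t
        using harm_f[of t] harm_f[of "t + 1"] that by (simp add: e_def lap_diff lap_shift)
      obtain t0 where t0: "u + 1 + B' \<le> t0" "t0 \<le> u + L - 1 - B'"
        and mx: "\<And>t. \<bar>t - t0\<bar> \<le> B' \<Longrightarrow> e t \<le> e t0"
      proof (rule interior_maximum[of e K B' "u + 1" "u + L - 1"])
        show "\<bar>e t\<bar> \<le> K" for t using K(2)[OF f] by (simp add: e_def)
      qed (use B' in \<open>auto simp: L_def\<close>)
      \<comment> \<open>For harmonic increments the Harnack inequality with \<open>c = 0\<close>
        turns the local maximum into local constancy.\<close>
      have eq: "e s = e t0" if s: "\<bar>s - t0\<bar> \<le> range_max" for s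
      proof (rule antisym)
        have "e s \<ge> e t0 - C * 0"
        proof (rule H[where e = e and s = s and c = 0])
          fix t assume t: "\<bar>t - t0\<bar> \<le> B"
          then have "\<bar>t - t0\<bar> \<le> B'" using range_max_pos by (simp add: B'_def)
          moreover from this have "u + 1 \<le> t" "t \<le> u + L - 1" using t0 by linarith+
          ultimately show "e t \<le> e t0 \<and> lap e t \<ge> - 0" using mx harm by simp
        qed (use s in auto)
        then show "e s \<ge> e t0" by simp
        show "e s \<le> e t0" by (rule mx) (use s BC in \<open>auto simp: B'_def\<close>)
      qed
      \<comment> \<open>The flux is thus an integer multiple of \<open>mass\<close>, impossible
        strictly between 0 and \<open>mass\<close>.\<close>
      have "flux f t0 = mass * e t0"
        unfolding e_def by (rule flux_eq) (rule eq[unfolded e_def])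
      moreover have "flux f t0 = flux f u"
        by (rule const) (use t0 B' in auto)
      ultimately have "mass * 0 < mass * e t0" "mass * e t0 < mass * 1" using fl by linarith+
      then have "0 < e t0" "e t0 < 1"
        using mult_less_cancel_left_pos[OF mass_pos] by blast+
      then show False by simp
    qed
  qed
qed

text \<open>The flux leaves the value \<open>mass\<close> just after some \<open>a\<close> and
  reaches 0 by \<open>a + T\<close>. Unique continuation from both infinities gives
  \<open>f s = s\<close> up to \<open>a\<close> and \<open>f s = 0\<close> from \<open>a + T\<close>
  on; the constraint \<open>f s \<le> min 0 s\<close> then traps 0 between the two points, which
  makes the window independent of \<open>f\<close>.\<close>

lemma profile_support:
  obtains T where "T \<ge> 0" "\<And>f t. \<lbrakk>profile f; \<bar>t\<bar> > T\<rbrakk> \<Longrightarrow> f t = min 0 t"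
proof -
  obtain L where L: "L \<ge> 0"
    and plateau: "\<And>f t. \<lbrakk>profile f; 0 < flux f t; flux f t < mass\<rbrakk> \<Longrightarrow> flux f (t + L) < flux f t"
    by (erule flux_plateau_bound)
  \<comment> \<open>One step for the first drop, then \<open>mass\<close> blocks of length
    \<open>L\<close>, each lowering a positive flux by at least 1.\<close>
  define T where "T = 1 + mass * L"
  have T: "T \<ge> 0" using L mass_pos by (simp add: T_def)
  show thesis
  proof
    show "T \<ge> 0" by fact
    fix f t assume f: "profile f" and t: "\<bar>t\<bar> > T"
    obtain S where S: "S \<ge> 0" "\<forall>t< - S. flux f t = mass" "\<forall>t>S. flux f t = 0"
      using flux_far[OF f] by blast
    obtain S' where S': "\<And>t. \<bar>t\<bar> > S' \<Longrightarrow> f t = min 0 t"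
      using f by (auto simp: profile_def)
    have "\<exists>a. flux f a = mass \<and> flux f (a + 1) < mass"
    proof (rule ccontr)
      assume no: "\<not> ?thesis"
      have "flux f s = mass" if "s \<ge> - S - 1" for s
        using that
      proof (induction s rule: int_ge_induct)
        case base
        then show ?case using S by simp
      next
        case (step s)
        then show ?case using no flux_bounds(2)[OF f, of "s + 1"] by force
      qed
      from this[of "S + 1"] show False using S mass_pos by simp
    qed
    then obtain a where a: "flux f a = mass" "flux f (a + 1) < mass" by blast
    have descent: "flux f (a + 1 + int j * L) \<le> max 0 (mass - 1 - int j)" for j
    proof (induction j)
      case 0
      then show ?case using a by simp
    next
      case (Suc j)
      let ?s = "a + 1 + int j * L"
      have next_eq: "a + 1 + int (Suc j) * L = ?s + L" by (simp add: algebra_simps)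
      have "flux f ?s \<le> flux f (a + 1)" using L by (intro flux_antimono f) simp
      then have lt: "flux f ?s < mass" using a by simp
      show ?case
      proof (cases "flux f ?s > 0")
        case True
        then show ?thesis using plateau[OF f True lt] Suc unfolding next_eq by linarith
      next
        case False
        have "flux f (?s + L) \<le> flux f ?s" using L by (intro flux_antimono f) simp
        then show ?thesis using False unfolding next_eq by linarith
      qed
    qed
    define b where "b = a + T"
    have "flux f b \<le> 0"
      using descent[of "nat mass"] mass_pos by (simp add: b_def T_def add.assoc)
    have right0: "flux f s = 0" if "s \<ge> b" for s
      using flux_antimono[OF f that] flux_bounds(1)[OF f, of s] \<open>flux f b \<le> 0\<close> by simp
    have left0: "flux f s = mass" if "s \<le> a" for s
      using flux_antimono[OF f that] flux_bounds(2)[OF f, of s] a by simp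
    have left: "f s = s" if "s \<le> a" for s
    proof -
      have "f s - s = 0"
      proof (rule harmonic_continuation[where h = "\<lambda>t. f t - t" and u = "- \<bar>S'\<bar>" and a = a])
        show "lap (\<lambda>t. f t - t) r = 0" if "r \<le> a" for r
          using flux_step[of f r] left0[of r] left0[of "r - 1"] that by (simp add: lap_diff lap_ident)
        show "f r - r = 0" if "r < - \<bar>S'\<bar>" for r
          using S'[of r] that by auto
        show "s \<le> a + range_max" using that range_max_pos by simp
      qed
      then show ?thesis by simp
    qed
    have right: "f s = 0" if "s \<ge> b" for s
    proof -
      \<comment> \<open>Reflection reduces this to continuation from the left. \<open>lap f\<close>
        is known to vanish from \<open>b + 1\<close> on, as it compares the flux at two adjacent
        points; the gain of \<open>range_max\<close> in the continuation still covers
        \<open>s = b\<close>.\<close>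
      have "f (- (- s)) = 0"
      proof (rule harmonic_continuation[where h = "\<lambda>t. f (- t)" and u = "- \<bar>S'\<bar>" and a = "- b - 1"])
        show "lap (\<lambda>t. f (- t)) r = 0" if "r \<le> - b - 1" for r
          using flux_step[of f "- r"] right0[of "- r"] right0[of "- r - 1"] that
          by (simp add: lap_reflect)
        show "f (- r) = 0" if "r < - \<bar>S'\<bar>" for r
          using S'[of "- r"] that by auto
        show "- s \<le> - b - 1 + range_max" using that range_max_pos by simp
      qed
      then show ?thesis by simp
    qed
    have below: "f s \<le> min 0 s" for s using f by (simp add: profile_def)
    have "a \<le> 0" using left[of a] below[of a] by simp
    moreover have "b \<ge> 0" using right[of b] below[of b] by simp
    ultimately have "t \<le> a \<or> t \<ge> b" "- T \<le> a" "b \<le> T"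
      using t by (auto simp: b_def)
    then show "f t = min 0 t"
      using left[of t] right[of t] t \<open>a \<le> 0\<close> \<open>b \<ge> 0\<close> by (auto simp: min_def)
  qed
qed

text \<open>From the known value at \<open>- T - 1\<close>, any point of the window is reached by at
  most \<open>2 * T + 1\<close> increments, each at least \<open>- K\<close>.\<close>

lemma profile_lower_bound:
  obtains N where "N \<ge> 0" "\<And>f t. profile f \<Longrightarrow> f t \<ge> min 0 t - N"
proof -
  obtain T where T: "T \<ge> 0" "\<And>f t. \<lbrakk>profile f; \<bar>t\<bar> > T\<rbrakk> \<Longrightarrow> f t = min 0 t"
    by (rule profile_support) blast
  obtain K where K: "K \<ge> 0" "\<And>f t. profile f \<Longrightarrow> \<bar>f (t + 1) - f t\<bar> \<le> K"
    by (erule increment_bound)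
  define N where "N = T + 1 + (2 * T + 1) * K"
  show thesis
  proof
    show "N \<ge> 0" using T(1) K(1) by (simp add: N_def)
    fix f t assume f: "profile f"
    show "f t \<ge> min 0 t - N"
    proof (cases "\<bar>t\<bar> > T")
      case True
      then show ?thesis using T(2)[OF f True] \<open>N \<ge> 0\<close> by linarith
    next
      case False
      define k where "k = nat (t + T + 1)"
      have k: "int k = t + T + 1" using False by (simp add: k_def)
      have "f (- T - 1 + int k) - f (- T - 1) \<ge> int k * (- K)"
      proof (rule increment_ge)
        show "- K \<le> f (s + 1) - f s" for s using K(2)[OF f, of s] by (simp add: abs_le_iff)
      qed
      moreover have "f (- T - 1) = - T - 1" using T(2)[OF f, of "- T - 1"] T(1) by simp
      ultimately have "f t \<ge> - T - 1 - int k * K"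
        by (simp add: k)
      moreover have "int k * K \<le> (2 * T + 1) * K"
        using False K(1) k by (intro mult_right_mono) auto
      ultimately show ?thesis by (simp add: N_def)
    qed
  qed
qed

end

section \<open>Reduction to the line\<close>

lemma neighbours_eq:
  fixes z :: "int ^ 'n"
  shows "neighbours z = (\<lambda>(i, s). z + axis i s) ` (UNIV \<times> {1, - 1})"
proof (intro equalityI subsetI)
  fix w assume "w \<in> neighbours z"
  then have "sqrt (\<Sum>i\<in>UNIV. (real_of_int (z $ i - w $ i))\<^sup>2) = 1"
    by (simp add: neighbours_def dist_real_vec)
  then have "(\<Sum>i\<in>UNIV. (real_of_int (z $ i - w $ i))\<^sup>2) = 1" by simp
  moreover have "(\<Sum>i\<in>UNIV. (real_of_int (z $ i - w $ i))\<^sup>2)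
      = real_of_int (\<Sum>i\<in>UNIV. (w $ i - z $ i)\<^sup>2)"
    by (simp add: power2_commute)
  ultimately have sum1: "(\<Sum>i\<in>UNIV. (w $ i - z $ i)\<^sup>2) = 1" by linarith
  then obtain i where i: "w $ i - z $ i \<noteq> 0"
    by (metis (no_types, lifting) power_zero_numeral sum.neutral zero_neq_one)
  have "(\<Sum>i\<in>UNIV. (w $ i - z $ i)\<^sup>2)
      = (w $ i - z $ i)\<^sup>2 + (\<Sum>j\<in>UNIV - {i}. (w $ j - z $ j)\<^sup>2)"
    by (rule sum.remove) auto
  moreover have "(w $ i - z $ i)\<^sup>2 > 0" using i by simp
  moreover have "(\<Sum>j\<in>UNIV - {i}. (w $ j - z $ j)\<^sup>2) \<ge> 0" by (rule sum_nonneg) simp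
  \<comment> \<open>A nonzero integer square is at least 1, so it exhausts the sum and the other
    coordinates agree.\<close>
  ultimately have 1: "(w $ i - z $ i)\<^sup>2 = 1"
    and 0: "(\<Sum>j\<in>UNIV - {i}. (w $ j - z $ j)\<^sup>2) = 0" using sum1 by linarith+
  from 1 have "w $ i - z $ i = 1 \<or> w $ i - z $ i = - 1" by (simp add: power2_eq_1_iff)
  moreover have "w $ j = z $ j" if "j \<noteq> i" for j
    using 0 that by (subst (asm) sum_nonneg_eq_0_iff) auto
  ultimately have "w = z + axis i (w $ i - z $ i)" "w $ i - z $ i \<in> {1, - 1}"
    by (auto simp: vec_eq_iff axis_def)
  then show "w \<in> (\<lambda>(i, s). z + axis i s) ` (UNIV \<times> {1, - 1})"
    by (intro image_eqI[of _ _ "(i, w $ i - z $ i)"]) auto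
next
  fix w assume "w \<in> (\<lambda>(i, s). z + axis i s) ` (UNIV \<times> {1, - 1})"
  then obtain i s where w: "w = z + axis i s" and s: "s = 1 \<or> s = - 1" by auto
  have "(\<Sum>j\<in>UNIV. (real_of_int (z $ j - w $ j))\<^sup>2) = (\<Sum>j\<in>UNIV. if j = i then 1 else 0)"
    by (rule sum.cong) (use s in \<open>auto simp: w axis_def\<close>)
  then show "w \<in> neighbours z" by (simp add: neighbours_def dist_real_vec)
qed

lemma laplacian_eq:
  fixes z :: "int ^ 'n"
  shows "laplacian F z = (\<Sum>i\<in>UNIV. F (z + axis i 1) + F (z + axis i (- 1)) - 2 * F z)"
proof -
  have inj: "inj_on (\<lambda>(i, s). z + axis i s) (UNIV \<times> {1, - 1 :: int})"
    by (auto simp: inj_on_def axis_eq_axis)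
  have "(\<Sum>w\<in>neighbours z. F w) = (\<Sum>(i, s)\<in>UNIV \<times> {1, - 1}. F (z + axis i s))"
    unfolding neighbours_eq by (subst sum.reindex[OF inj]) (simp add: case_prod_unfold)
  also have "\<dots> = (\<Sum>i\<in>UNIV. F (z + axis i 1) + F (z + axis i (- 1)))"
    by (simp flip: sum.cartesian_product)
  finally show ?thesis
    by (simp add: laplacian_def sum_subtractf)
qed

lemma scalar_product_simps:
  fixes p :: "int ^ 'n"
  shows "scalar_product p (z + w) = scalar_product p z + scalar_product p w"
    and "scalar_product p (z - w) = scalar_product p z - scalar_product p w"
    and "scalar_product p (k *s z) = k * scalar_product p z"
    and "scalar_product p (axis i s) = p $ i * s"
  by (simp_all add: scalar_product_def algebra_simps sum.distrib sum_subtractf sum_distrib_left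
      axis_def if_distrib cong: if_cong)

text \<open>Bezout: the least positive value \<open>d\<close> of the form divides every coordinate,
  since a nonzero remainder would be a smaller positive value. Primitivity then forces
  \<open>d = 1\<close>.\<close>

lemma primitive_scalar_product_surj:
  fixes p :: "int ^ 'n"
  assumes "primitive_vec p"
  shows "\<exists>z. scalar_product p z = m"
proof -
  define A where "A = (\<lambda>d::nat. d > 0 \<and> (\<exists>z. scalar_product p z = int d))"
  obtain i where i: "p $ i \<noteq> 0"
    using assms by (auto simp: primitive_vec_def vec_eq_iff)
  have "scalar_product p (axis i (sgn (p $ i))) = int (nat \<bar>p $ i\<bar>)"
    by (simp add: scalar_product_simps flip: abs_sgn)
  with i have ex: "A (nat \<bar>p $ i\<bar>)" unfolding A_def by auto
  define d where "d = Least A"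
  have "A d" unfolding d_def by (rule LeastI) (rule ex)
  then obtain z where d: "d > 0" and z: "scalar_product p z = int d" by (auto simp: A_def)
  have dvd: "int d dvd p $ j" for j
  proof (rule ccontr)
    assume "\<not> int d dvd p $ j"
    then have "p $ j mod int d \<noteq> 0" using mod_0_imp_dvd by blast
    then have r: "0 < p $ j mod int d" "p $ j mod int d < int d"
      using d pos_mod_sign[of "int d" "p $ j"] pos_mod_bound[of "int d" "p $ j"] by linarith+
    have "scalar_product p (axis j 1 - (p $ j div int d) *s z) = int (nat (p $ j mod int d))"
      using r by (simp add: scalar_product_simps z minus_div_mult_eq_mod)
    then have "A (nat (p $ j mod int d))" using r unfolding A_def by fastforce
    then have "d \<le> nat (p $ j mod int d)" unfolding d_def by (rule Least_le)
    then show False using r by simp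
  qed
  have "p = int d *s (\<chi> j. p $ j div int d)"
    using dvd by (simp add: vec_eq_iff)
  then have "\<not> int d > 1" using assms unfolding primitive_vec_def by blast
  then have "d = 1" using d by simp
  then have "scalar_product p (m *s z) = m" by (simp add: scalar_product_simps z)
  then show ?thesis by blast
qed

definition abs_coord :: "int ^ 'n \<Rightarrow> 'n \<Rightarrow> nat" where
  "abs_coord p i = nat \<bar>p $ i\<bar>"

lemma generating_steps_abs_coord:
  fixes p :: "int ^ 'n"
  assumes "primitive_vec p"
  shows "generating_steps (abs_coord p)"
proof
  fix m
  obtain z where "scalar_product p z = m"
    using primitive_scalar_product_surj[OF assms] by blast
  then have "m = (\<Sum>i\<in>UNIV. (z $ i * sgn (p $ i)) * int (abs_coord p i))"
    by (simp add: scalar_product_def abs_coord_def mult.assoc sgn_mult_abs mult.commute[of "p $ _"])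
  then show "\<exists>v. m = (\<Sum>i\<in>UNIV. v i * int (abs_coord p i))" by (rule exI[where x = "\<lambda>i. z $ i * sgn (p $ i)"])
qed

lemma abs_scalar_product_le:
  fixes p z :: "int ^ 'n"
  shows "\<bar>real_of_int (scalar_product p z)\<bar> \<le> real_of_int (\<Sum>i\<in>UNIV. \<bar>p $ i\<bar>) * norm (real_vec z)"
proof -
  have "\<bar>real_of_int (scalar_product p z)\<bar> \<le> (\<Sum>i\<in>UNIV. \<bar>real_of_int (p $ i) * real_vec z $ i\<bar>)"
    by (simp add: scalar_product_def real_vec_def)
  also have "\<dots> \<le> (\<Sum>i\<in>UNIV. \<bar>real_of_int (p $ i)\<bar> * norm (real_vec z))"
    by (rule sum_mono) (auto simp: abs_mult intro!: mult_left_mono component_le_norm_cart)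
  finally show ?thesis by (simp add: sum_distrib_right)
qed

lemma real_vec_diff: "real_vec (z - w) = real_vec z - real_vec w"
  by (simp add: real_vec_def vec_eq_iff)

section \<open>The deviation set as a strip around the hyperplane\<close>

lemma deviation_set_edge_fun_subset:
  fixes p :: "int ^ 'n"
  shows "deviation_set (edge_fun p) \<subseteq> {z. \<bar>scalar_product p z\<bar> \<le> (\<Sum>i\<in>UNIV. \<bar>p $ i\<bar>)}"
proof
  fix z assume "z \<in> deviation_set (edge_fun p)"
  then have dev: "laplacian (edge_fun p) z \<noteq> 0" by (simp add: deviation_set_def)
  show "z \<in> {z. \<bar>scalar_product p z\<bar> \<le> (\<Sum>i\<in>UNIV. \<bar>p $ i\<bar>)}"
  proof (rule ccontr)
    assume "z \<notin> {z. \<bar>scalar_product p z\<bar> \<le> (\<Sum>i\<in>UNIV. \<bar>p $ i\<bar>)}"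
    then have far: "\<bar>scalar_product p z\<bar> > (\<Sum>i\<in>UNIV. \<bar>p $ i\<bar>)" by simp
    have "\<bar>p $ i\<bar> \<le> (\<Sum>i\<in>UNIV. \<bar>p $ i\<bar>)" for i
      by (rule member_le_sum) auto
    \<comment> \<open>So \<open>z\<close> and its neighbours lie strictly on one side of the
      hyperplane, where \<open>edge_fun p\<close> is linear.\<close>
    then have small: "\<bar>p $ i\<bar> < \<bar>scalar_product p z\<bar>" for i using far by (meson le_less_trans)
    have "edge_fun p (z + axis i 1) + edge_fun p (z + axis i (- 1)) - 2 * edge_fun p z = 0" for i
      using small[of i] by (auto simp: edge_fun_def scalar_product_simps min_def)
    then show False using dev by (simp add: laplacian_eq)
  qed
qed

lemma hyperplane_subset_deviation_set:
  fixes p :: "int ^ 'n"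
  assumes "p \<noteq> 0"
  shows "{z. scalar_product p z = 0} \<subseteq> deviation_set (edge_fun p)"
proof
  fix z assume "z \<in> {z. scalar_product p z = 0}"
  then have z: "scalar_product p z = 0" by simp
  obtain i where i: "p $ i \<noteq> 0" using assms by (auto simp: vec_eq_iff)
  have "laplacian (edge_fun p) z = (\<Sum>i\<in>UNIV. - \<bar>p $ i\<bar>)"
    unfolding laplacian_eq
    by (rule sum.cong) (auto simp: edge_fun_def scalar_product_simps z min_def)
  moreover have "(\<Sum>i\<in>UNIV. \<bar>p $ i\<bar>) > 0"
    by (rule sum_pos2[of _ i]) (use i in auto)
  ultimately show "z \<in> deviation_set (edge_fun p)" by (simp add: deviation_set_def sum_negf)
qed

text \<open>A point of the strip is moved onto the hyperplane, hence into the deviation set, by one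
  of finitely many fixed translations, one for each value of the form.\<close>

lemma strip_subset_lattice_nbhd:
  fixes p :: "int ^ 'n"
  assumes "primitive_vec p"
  obtains C where "C > 0"
    "{z. \<bar>scalar_product p z\<bar> \<le> T} \<subseteq> lattice_nbhd C (deviation_set (edge_fun p))"
proof -
  obtain v where v: "\<And>m. scalar_product p (v m) = m"
    using primitive_scalar_product_surj[OF assms] by metis
  define C where "C = 1 + (\<Sum>m\<in>{- T..T}. norm (real_vec (v m)))"
  show thesis
  proof
    show "C > 0" by (auto simp: C_def intro!: add_pos_nonneg sum_nonneg)
    show "{z. \<bar>scalar_product p z\<bar> \<le> T} \<subseteq> lattice_nbhd C (deviation_set (edge_fun p))"
    proof
      fix z assume "z \<in> {z. \<bar>scalar_product p z\<bar> \<le> T}"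
      then have m: "scalar_product p z \<in> {- T..T}" by auto
      define w where "w = z - v (scalar_product p z)"
      have "scalar_product p w = 0" by (simp add: w_def scalar_product_simps v)
      then have "w \<in> deviation_set (edge_fun p)"
        using hyperplane_subset_deviation_set[of p] assms by (auto simp: primitive_vec_def)
      moreover have "dist (real_vec z) (real_vec w) \<le> C"
        using member_le_sum[OF m, of "\<lambda>m. norm (real_vec (v m))"]
        by (simp add: C_def w_def dist_norm real_vec_diff)
      ultimately show "z \<in> lattice_nbhd C (deviation_set (edge_fun p))"
        unfolding mem_lattice_nbhd_iff by blast
    qed
  qed
qed

section \<open>Minima over the fibres of the linear form\<close>

definition fibre_min :: "int ^ 'n \<Rightarrow> (int ^ 'n \<Rightarrow> int) \<Rightarrow> int \<Rightarrow> int" where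
  "fibre_min p G t = Min (G ` {z. scalar_product p z = t})"

context
  fixes p :: "int ^ 'n" and G k
  assumes prim: "primitive_vec p" and G: "G \<in> husking_class k (edge_fun p)"
begin

text \<open>A fibre may be infinite, but \<open>G\<close> takes only integer values between
  \<open>min 0 t - k\<close> and \<open>min 0 t\<close> on it, so \<open>Min\<close> is
  meaningful.\<close>

lemma finite_fibre_values: "finite (G ` {z. scalar_product p z = t})"
  by (rule finite_subset[of _ "{min 0 t - int k..min 0 t}"])
    (use G in \<open>auto simp: husking_class_def edge_fun_def\<close>)

lemma fibre_min_le: "fibre_min p G (scalar_product p z) \<le> G z"
  unfolding fibre_min_def by (rule Min_le[OF finite_fibre_values]) auto

lemma fibre_min_attained: "\<exists>z. scalar_product p z = t \<and> G z = fibre_min p G t"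
proof -
  have "G ` {z. scalar_product p z = t} \<noteq> {}"
    using primitive_scalar_product_surj[OF prim] by auto
  from Min_in[OF finite_fibre_values this] show ?thesis by (auto simp: fibre_min_def)
qed

text \<open>At a minimiser \<open>z\<close> of its fibre, replacing the neighbouring values of
  \<open>G\<close> by their fibre minima lowers the sum and leaves the central value alone, so
  superharmonicity descends to the line.\<close>

lemma profile_fibre_min: "generating_steps.profile (abs_coord p) (fibre_min p G)"
proof -
  interpret generating_steps "abs_coord p"
    by (rule generating_steps_abs_coord[OF prim])
  let ?g = "fibre_min p G"
  have "lap ?g t \<le> 0" for t
  proof -
    obtain z where z: "scalar_product p z = t" "G z = ?g t" using fibre_min_attained by blast
    have "lap ?g t \<le> laplacian G z"
      unfolding lap_def laplacian_eq
    proof (rule sum_mono)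
      fix i
      have "?g (t + p $ i) \<le> G (z + axis i 1)" "?g (t - p $ i) \<le> G (z + axis i (- 1))"
        using fibre_min_le[of "z + axis i 1"] fibre_min_le[of "z + axis i (- 1)"]
        by (simp_all add: scalar_product_simps z)
      then show "?g (t + int (abs_coord p i)) + ?g (t - int (abs_coord p i)) - 2 * ?g t
          \<le> G (z + axis i 1) + G (z + axis i (- 1)) - 2 * G z"
        by (cases "p $ i \<ge> 0") (simp_all add: abs_coord_def z)
    qed
    also have "\<dots> \<le> 0" using G by (simp add: husking_class_def superharmonic_def)
    finally show ?thesis .
  qed
  moreover have "?g t \<le> min 0 t" for t
  proof -
    obtain z where "scalar_product p z = t" "G z = ?g t" using fibre_min_attained by blast
    moreover have "G z \<le> edge_fun p z" using G by (simp add: husking_class_def)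
    ultimately show ?thesis by (simp add: edge_fun_def)
  qed
  moreover have "\<exists>S. \<forall>t. \<bar>t\<bar> > S \<longrightarrow> ?g t = min 0 t"
  proof -
    obtain C where C: "{z. edge_fun p z \<noteq> G z} \<subseteq> lattice_nbhd C (deviation_set (edge_fun p))"
      using G by (auto simp: husking_class_def)
    define P where "P = (\<Sum>i\<in>UNIV. \<bar>p $ i\<bar>)"
    have P: "P \<ge> 0" by (simp add: P_def sum_nonneg)
    \<comment> \<open>On the deviation set the form is at most \<open>P\<close> in absolute value,
      and moving by a distance of at most \<open>C\<close> changes it by at most
      \<open>P * C\<close>.\<close>
    define S where "S = \<lceil>real_of_int P + real_of_int P * C\<rceil>"
    have "?g t = min 0 t" if t: "\<bar>t\<bar> > S" for t
    proof (rule ccontr)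
      assume ne: "?g t \<noteq> min 0 t"
      obtain z where z: "scalar_product p z = t" "G z = ?g t" using fibre_min_attained by blast
      with ne have "z \<in> lattice_nbhd C (deviation_set (edge_fun p))"
        using C by (auto simp: edge_fun_def)
      then obtain w where w: "w \<in> deviation_set (edge_fun p)"
        and d: "dist (real_vec z) (real_vec w) \<le> C" by (auto simp: mem_lattice_nbhd_iff)
      have "\<bar>scalar_product p w\<bar> \<le> P"
        using w deviation_set_edge_fun_subset[of p] by (auto simp: P_def)
      then have 1: "\<bar>real_of_int (scalar_product p w)\<bar> \<le> real_of_int P" by linarith
      have "\<bar>real_of_int (scalar_product p (z - w))\<bar> \<le> real_of_int P * norm (real_vec (z - w))"
        unfolding P_def by (rule abs_scalar_product_le)
      also have "\<dots> \<le> real_of_int P * C"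
        using d P by (intro mult_left_mono) (auto simp: dist_norm real_vec_diff)
      finally have "\<bar>real_of_int t - real_of_int (scalar_product p w)\<bar> \<le> real_of_int P * C"
        by (simp add: scalar_product_simps z)
      with 1 have "\<bar>real_of_int t\<bar> \<le> real_of_int P + real_of_int P * C" by linarith
      then have "\<bar>t\<bar> \<le> S" unfolding S_def by linarith
      with t show False by simp
    qed
    then show ?thesis by blast
  qed
  ultimately show ?thesis by (simp add: profile_def)
qed

end

theorem theorem2:
  fixes p :: "int ^ 'n"
  assumes "primitive_vec p"
  shows "\<exists>N>0. (\<forall>k>N. husking k (edge_fun p) = husking N (edge_fun p)) \<and>
    (\<exists>C>0. {z. husking N (edge_fun p) z \<noteq> edge_fun p z}
            \<subseteq> lattice_nbhd C (deviation_set (edge_fun p)))"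
proof -
  interpret generating_steps "abs_coord p"
    by (rule generating_steps_abs_coord[OF assms])
  obtain T where T: "\<And>f t. \<lbrakk>profile f; \<bar>t\<bar> > T\<rbrakk> \<Longrightarrow> f t = min 0 t"
    by (rule profile_support) blast
  obtain N' where N': "N' \<ge> 0" "\<And>f t. profile f \<Longrightarrow> f t \<ge> min 0 t - N'"
    by (rule profile_lower_bound) blast
  obtain C where C: "C > 0"
    "{z. \<bar>scalar_product p z\<bar> \<le> T} \<subseteq> lattice_nbhd C (deviation_set (edge_fun p))"
    by (rule strip_subset_lattice_nbhd[OF assms])
  define N where "N = nat N' + 1"
  \<comment> \<open>Both facts hold with \<open>N\<close> and \<open>T\<close> independent of
    \<open>k\<close> and \<open>G\<close>, because the bounds on profiles are uniform.\<close>
  have lower: "G z \<ge> edge_fun p z - int N"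
    and agree: "\<bar>scalar_product p z\<bar> > T \<Longrightarrow> G z = edge_fun p z"
    if G: "G \<in> husking_class k (edge_fun p)" for G k z
  proof -
    note prof = profile_fibre_min[OF assms G] and le = fibre_min_le[OF assms G, of z]
    show "G z \<ge> edge_fun p z - int N"
      using N'(2)[OF prof, of "scalar_product p z"] le N'(1) by (simp add: edge_fun_def N_def)
    show "G z = edge_fun p z" if "\<bar>scalar_product p z\<bar> > T"
    proof (rule antisym)
      show "G z \<le> edge_fun p z" using G by (simp add: husking_class_def)
      show "edge_fun p z \<le> G z" using T[OF prof that] le by (simp add: edge_fun_def)
    qed
  qed
  have "husking_class k (edge_fun p) = husking_class N (edge_fun p)" if "k > N" for k
  proof (intro equalityI subsetI)
    fix G assume G: "G \<in> husking_class k (edge_fun p)"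
    with lower[OF G] show "G \<in> husking_class N (edge_fun p)" by (simp add: husking_class_def)
  next
    fix G assume G: "G \<in> husking_class N (edge_fun p)"
    moreover have "edge_fun p z - int k \<le> G z" for z
      using lower[OF G, of z] that by linarith
    ultimately show "G \<in> husking_class k (edge_fun p)" by (simp add: husking_class_def)
  qed
  then have stable: "\<forall>k>N. husking k (edge_fun p) = husking N (edge_fun p)"
    by (auto simp: husking_def fun_eq_iff)
  have "superharmonic (edge_fun p)"
    unfolding superharmonic_def laplacian_eq
    by (auto intro!: sum_nonpos simp: edge_fun_def scalar_product_simps)
  then have self: "edge_fun p \<in> husking_class N (edge_fun p)" by (rule husking_class_self)
  have "husking N (edge_fun p) z = edge_fun p z" if "\<bar>scalar_product p z\<bar> > T" for z
  proof -
    \<comment> \<open>Off the strip all members of the class agree with \<open>edge_fun p\<close>,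
      and the class is nonempty, so \<open>Min\<close> is taken over a singleton.\<close>
    have "{G z | G. G \<in> husking_class N (edge_fun p)} = {edge_fun p z}"
      using agree[OF _ that] self by blast
    then show ?thesis by (simp add: husking_def)
  qed
  then have "{z. husking N (edge_fun p) z \<noteq> edge_fun p z} \<subseteq> {z. \<bar>scalar_product p z\<bar> \<le> T}"
    by force
  then have "{z. husking N (edge_fun p) z \<noteq> edge_fun p z}
      \<subseteq> lattice_nbhd C (deviation_set (edge_fun p))"
    using C(2) by (rule order_trans)
  with stable C(1) show ?thesis
    by (intro exI[of _ N]) (auto simp: N_def)
qed

end
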